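(* For every complex number $q$ with $|q|<1$, $$\sum_{k=0}^\infty \frac{q^{2k}\,P_2(q^{2k+1})}{(1-q^{2k+1})^4}=\prod_{n=1}^\infty\frac{(1-q^{2n})^8}{(1-q^{2n-1})^8},$$ where $P_2(x)=x^2+4x+1$. *)

theory Defs
  imports "HOL-Analysis.Analysis"
begin

definition P2 :: "complex \<Rightarrow> complex" where
  "P2 x = x\<^sup>2 + 4 * x + 1"

end

theory Submission
  imports Defs
begin

text \<open>
  Write \<open>E = (1 - q\<^sup>2)(1 - q\<^sup>4)\<dots>\<close>, \<open>O = (1 - q)(1 - q\<^sup>3)\<dots>\<close> and \<open>x = q\<^bsup>2n+1\<^esup>\<close>.

  The identity for the fourth power, \<open>(E/O)\<^sup>4 = \<Sum>n\<ge>0. q\<^sup>n (1 + x) / (1 - x)\<^sup>2\<close>, is the limit of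
  Lagrange interpolation at the nodes \<open>1, q\<^sup>2, \<dots>, q\<^bsup>4N\<^esup>\<close>: the coefficients are products of two
  bounded quotients, so Tannery's theorem applies.

  For the eighth power consider \<open>g(y) = \<Sum>n\<in>\<int>. q\<^sup>n / (1 - x y)\<close>. Expanding \<open>q y g(y)\<^sup>2\<close> as a
  double sum over \<open>m\<close> and \<open>n = m + d\<close>, the diagonal gives \<open>S(y) = \<Sum>n\<in>\<int>. x y / (1 - x y)\<^sup>2\<close>, while for
  \<open>d \<noteq> 0\<close> partial fractions make the sum over \<open>m\<close> telescope to a constant independent of \<open>y\<close>.
  Since \<open>g(1) = 0\<close>, this means \<open>q y g(y)\<^sup>2 = S(y) - S(1)\<close>. Dividing by \<open>(y - 1)\<^sup>2\<close> and letting
  \<open>y\<close> tend to \<open>1\<close> turns the left-hand side into \<open>q (E/O)\<^sup>8\<close> and the right-hand side into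
  \<open>\<Sum>n\<ge>0. x P2(x) / (1 - x)\<^sup>4\<close>.
\<close>

subsection \<open>Finite partial fractions\<close>

text \<open>\<open>p\<close> and its interpolant \<open>L\<close> both have degree at most
  \<open>M\<close> and agree at \<open>M + 1\<close> distinct nodes, so they coincide. Dividing
  \<open>L\<close> by the nodal product at \<open>w\<close> leaves one simple fraction per
  node.\<close>

lemma Lagrange_partial_fractions:
  fixes p :: "'a::field poly" and z :: "nat \<Rightarrow> 'a"
  assumes inj: "inj_on z {..M}" and deg: "degree p \<le> M" and w: "w \<notin> z ` {..M}"
  shows "poly p w / (\<Prod>i\<le>M. w - z i) =
         (\<Sum>n\<le>M. poly p (z n) / ((w - z n) * (\<Prod>i\<in>{..M}-{n}. z n - z i)))"
proof -
  define D where "D n = (\<Prod>i\<in>{..M}-{n}. z n - z i)" for n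
  define B where "B n = (\<Prod>i\<in>{..M}-{n}. [:-z i, 1:])" for n
  define L where "L = (\<Sum>n\<le>M. smult (poly p (z n) / D n) (B n))"
  have D_nz: "D n \<noteq> 0" if "n \<le> M" for n
    using inj that by (auto simp: D_def inj_on_def)
  have poly_B: "poly (B n) x = (\<Prod>i\<in>{..M}-{n}. x - z i)" for n x
    by (simp add: B_def poly_prod)
  have B_z: "poly (B n) (z m) = (if n = m then D n else 0)" if "m \<le> M" for n m
    using that by (auto simp: poly_B D_def)
  have deg_B: "degree (B n) \<le> M" if "n \<le> M" for n
  proof -
    have "degree (B n) \<le> (\<Sum>i\<in>{..M}-{n}. degree [:-z i, 1:])"
      unfolding B_def by (rule order.trans[OF degree_prod_sum_le]) (auto simp: o_def)
    also have "\<dots> = M" using that by simp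
    finally show ?thesis .
  qed
  have "p = L"
  proof (rule poly_eqI_degree)
    fix x assume "x \<in> z ` {..M}"
    then obtain m where m: "m \<le> M" "x = z m" by auto
    have "poly L x = (\<Sum>n\<le>M. if n = m then poly p (z n) else 0)"
      unfolding L_def poly_sum by (intro sum.cong refl) (use m D_nz in \<open>auto simp: B_z\<close>)
    also have "\<dots> = poly p x" using m by simp
    finally show "poly p x = poly L x" ..
  next
    have "card (z ` {..M}) = Suc M" using card_image[OF inj] by simp
    moreover have "degree L \<le> M"
      unfolding L_def by (intro degree_sum_le) (auto intro: order.trans[OF degree_smult_le] deg_B)
    ultimately show "card (z ` {..M}) > degree p" "card (z ` {..M}) > degree L"
      using deg by auto
  qed
  have "poly p w / (\<Prod>i\<le>M. w - z i) = (\<Sum>n\<le>M. poly p (z n) / D n * (poly (B n) w / (\<Prod>i\<le>M. w - z i)))"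
    by (subst \<open>p = L\<close>, unfold L_def) (simp add: poly_sum sum_divide_distrib)
  also have "\<dots> = (\<Sum>n\<le>M. poly p (z n) / ((w - z n) * D n))"
  proof (intro sum.cong refl)
    fix n assume n: "n \<in> {..M}"
    have "(\<Prod>i\<le>M. w - z i) = (w - z n) * poly (B n) w"
      unfolding poly_B using n by (simp add: prod.remove)
    moreover have "poly (B n) w \<noteq> 0" "w - z n \<noteq> 0"
      using w n unfolding poly_B by auto
    ultimately show "poly p (z n) / D n * (poly (B n) w / (\<Prod>i\<le>M. w - z i)) = poly p (z n) / ((w - z n) * D n)"
      by simp
  qed
  finally show ?thesis unfolding D_def .
qed

text \<open>Indices below \<open>n\<close> are listed by their distance from \<open>n\<close>. In
  this order the differences between powers of \<open>q\<close> reduce to factors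
  \<open>1 - q ^ k\<close> in which \<open>n\<close> no longer occurs.\<close>

lemma prod_split_at:
  fixes f :: "nat \<Rightarrow> 'a::comm_monoid_mult"
  assumes "n \<le> M"
  shows "(\<Prod>i\<le>M. f i) = (\<Prod>i<n. f (n - Suc i)) * (f n * (\<Prod>i<M-n. f (Suc (n + i))))"
    and "(\<Prod>i\<in>{..M}-{n}. f i) = (\<Prod>i<n. f (n - Suc i)) * (\<Prod>i<M-n. f (Suc (n + i)))"
proof -
  have *: "{..M} - {n} = {..<n} \<union> {Suc n..M}" using assms by auto
  have "(\<Prod>i\<in>{Suc n..M}. f i) = (\<Prod>i<M-n. f (Suc (n + i)))"
    by (rule prod.reindex_bij_witness[of _ "\<lambda>i. Suc (n + i)" "\<lambda>i. i - Suc n"]) auto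
  then show 2: "(\<Prod>i\<in>{..M}-{n}. f i) = (\<Prod>i<n. f (n - Suc i)) * (\<Prod>i<M-n. f (Suc (n + i)))"
    unfolding * by (subst prod.union_disjoint) (auto simp: prod.nat_diff_reindex)
  show "(\<Prod>i\<le>M. f i) = (\<Prod>i<n. f (n - Suc i)) * (f n * (\<Prod>i<M-n. f (Suc (n + i))))"
    using assms by (subst prod.remove[of _ n]) (auto simp: 2 mult_ac)
qed

lemma sum_split_at:
  fixes f :: "nat \<Rightarrow> 'a::comm_monoid_add"
  shows "(\<Sum>n\<le>2*N. f n) = (\<Sum>k\<le>N. f (N - k)) + (\<Sum>i<N. f (Suc (N + i)))"
proof -
  have *: "{..2*N} = {..N} \<union> {Suc N..2*N}" by auto
  have "(\<Sum>i\<in>{Suc N..2*N}. f i) = (\<Sum>i<N. f (Suc (N + i)))"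
    by (rule sum.reindex_bij_witness[of _ "\<lambda>i. Suc (N + i)" "\<lambda>i. i - Suc N"]) auto
  moreover have "(\<Sum>i\<le>N. f i) = (\<Sum>k\<le>N. f (N - k))"
    by (rule sum.reindex_bij_witness[of _ "\<lambda>i. N - i" "\<lambda>i. N - i"]) auto
  ultimately show ?thesis
    unfolding * by (subst sum.union_disjoint) auto
qed

section \<open>Finite products over odd and even powers\<close>

definition oddprod :: "complex \<Rightarrow> nat \<Rightarrow> complex" where
  "oddprod q n = (\<Prod>i<n. 1 - q ^ (2 * i + 1))"

definition evenprod :: "complex \<Rightarrow> nat \<Rightarrow> complex" where
  "evenprod q n = (\<Prod>i<n. 1 - q ^ (2 * i + 2))"

text \<open>This is a q-analogue of binom(2n, n) / 4^n. It stays bounded and tends to O/E, which is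
  what dominated convergence asks of the interpolation coefficients.\<close>

definition prodquot :: "complex \<Rightarrow> nat \<Rightarrow> complex" where
  "prodquot q n = oddprod q n / evenprod q n"

lemma one_minus_power_nonzero:
  fixes q :: complex
  assumes "norm q < 1" "n > 0"
  shows "1 - q ^ n \<noteq> 0"
proof
  assume "1 - q ^ n = 0"
  then have "norm q ^ n = 1" by (metis eq_iff_diff_eq_0 norm_one norm_power)
  with assms show False using power_less_one_iff[of "norm q" n] by auto
qed

lemma power_eq_iff_norm_less_one:
  fixes q :: complex
  assumes "norm q < 1" "q \<noteq> 0"
  shows "q ^ m = q ^ n \<longleftrightarrow> m = n"
proof
  assume "q ^ m = q ^ n"
  then have "norm q ^ m = norm q ^ n" by (metis norm_power)
  then show "m = n" using assms power_inject_exp'[of "norm q" m n] by (simp add: norm_power)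
qed auto

subsection \<open>Series and infinite products\<close>

text \<open>Dominated convergence for series, with the summable weights separated from a uniformly
  bounded factor. The general filter serves both the limit over \<open>N\<close> and the limit of
  \<open>y\<close> to 1.\<close>

lemma tannery_bounded_factor:
  fixes c :: "nat \<Rightarrow> complex" and h :: "nat \<Rightarrow> 'a \<Rightarrow> complex"
  assumes c: "summable (\<lambda>k. norm (c k))" and bound: "\<forall>\<^sub>F y in F. \<forall>k. norm (h k y) \<le> B"
    and lim: "\<And>k. (h k \<longlongrightarrow> l k) F" and F: "F \<noteq> bot"
  shows "((\<lambda>y. \<Sum>k. c k * h k y) \<longlongrightarrow> (\<Sum>k. c k * l k)) F"
proof (rule conjunct2[OF conjunct2[OF tannerys_theorem]])
  show "((\<lambda>y. c k * h k y) \<longlongrightarrow> c k * l k) F" for k by (intro tendsto_intros lim)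
  have "\<forall>\<^sub>F p in sequentially \<times>\<^sub>F F. \<forall>k. norm (h k (snd p)) \<le> B"
    using bound eventually_compose_filterlim filterlim_snd by blast
  then show "\<forall>\<^sub>F (k, y) in sequentially \<times>\<^sub>F F. norm (c k * h k y) \<le> norm (c k) * B"
    by eventually_elim (auto simp: norm_mult intro: mult_left_mono)
  show "summable (\<lambda>k. norm (c k) * B)" by (intro summable_mult2 c)
qed (rule F)

text \<open>The truncation at \<open>g N\<close> is absorbed into the bounded factor, which is set
  to 0 beyond the cutoff. Each fixed \<open>k\<close> is eventually below the cutoff, so the
  pointwise limit is unaffected.\<close>

lemma tannery_weighted_sums:
  fixes c :: "nat \<Rightarrow> complex" and R :: "nat \<Rightarrow> nat \<Rightarrow> complex"
  assumes c: "summable (\<lambda>k. norm (c k))" and bound: "\<And>N k. norm (R N k) \<le> B"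
    and lim: "\<And>k. (\<lambda>N. R N k) \<longlonglongrightarrow> L" and g: "filterlim g at_top sequentially"
  shows "(\<lambda>N. \<Sum>k<g N. c k * R N k) \<longlonglongrightarrow> (\<Sum>k. c k) * L"
proof -
  have "((\<lambda>N. \<Sum>k. c k * (if k < g N then R N k else 0)) \<longlongrightarrow> (\<Sum>k. c k * L)) sequentially"
  proof (rule tannery_bounded_factor[OF c])
    show "(\<lambda>N. if k < g N then R N k else 0) \<longlonglongrightarrow> L" for k
    proof (rule Lim_transform_eventually[OF lim])
      show "\<forall>\<^sub>F N in sequentially. R N k = (if k < g N then R N k else 0)"
        using filterlim_at_top[THEN iffD1, OF g, rule_format, of "Suc k"] by eventually_elim auto
    qed
    have "B \<ge> 0" using bound[of 0 0] norm_ge_zero order.trans by blast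
    then show "\<forall>\<^sub>F N in sequentially. \<forall>k. norm (if k < g N then R N k else 0) \<le> B"
      by (simp add: bound)
  qed simp
  moreover have "(\<Sum>k. c k * (if k < g N then R N k else 0)) = (\<Sum>k<g N. c k * R N k)" for N
    by (subst suminf_finite[of "{..<g N}"]) auto
  moreover have "(\<Sum>k. c k * L) = (\<Sum>k. c k) * L"
    using suminf_mult2[OF summable_norm_cancel[OF c], of L] by simp
  ultimately show ?thesis by simp
qed

lemma norm_one_minus_power_ge:
  fixes q :: complex
  assumes "norm q < 1" "n > 0"
  shows "norm (1 - q ^ n) \<ge> 1 - norm q"
proof -
  have "norm q ^ n \<le> norm q ^ 1" using assms by (intro power_decreasing) auto
  then have "norm (q ^ n) \<le> norm q" by (simp add: norm_power)
  then show ?thesis using norm_triangle_ineq2[of 1 "q ^ n"] by simp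
qed

lemma summable_power_comparison:
  fixes q :: complex and f :: "nat \<Rightarrow> complex"
  assumes "norm q < 1" "\<And>n. norm (f n) \<le> C * norm q ^ n"
  shows "summable (\<lambda>n. norm (f n))"
  by (rule summable_comparison_test[of _ "\<lambda>n. C * norm q ^ n"])
     (use assms in \<open>auto intro!: summable_mult summable_geometric\<close>)

definition oddprodinf :: "complex \<Rightarrow> complex" where
  "oddprodinf q = (\<Prod>i. 1 - q ^ (2 * i + 1))"

definition evenprodinf :: "complex \<Rightarrow> complex" where
  "evenprodinf q = (\<Prod>i. 1 - q ^ (2 * i + 2))"

lemma
  assumes "norm q < 1"
  shows has_prod_oddprodinf: "(\<lambda>i. 1 - q ^ (2 * i + 1)) has_prod oddprodinf q"
    and oddprodinf_nonzero: "oddprodinf q \<noteq> 0"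
    and LIMSEQ_oddprod: "oddprod q \<longlonglongrightarrow> oddprodinf q"
    and has_prod_evenprodinf: "(\<lambda>i. 1 - q ^ (2 * i + 2)) has_prod evenprodinf q"
    and evenprodinf_nonzero: "evenprodinf q \<noteq> 0"
    and LIMSEQ_evenprod: "evenprod q \<longlonglongrightarrow> evenprodinf q"
proof -
  \<comment> \<open>The offsets \<open>c = 0\<close> and \<open>c = 1\<close> give the odd and the
    even exponents.\<close>
  have conv: "convergent_prod (\<lambda>i. 1 - q ^ (2 * i + Suc c))" for c
  proof -
    have "norm (- (q ^ (2 * i + Suc c))) \<le> 1 * norm q ^ i" for i
      using assms by (auto simp: norm_power intro!: power_decreasing simp del: power_Suc)
    then have "summable (\<lambda>i. norm (- (q ^ (2 * i + Suc c))))"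
      by (rule summable_power_comparison[OF assms])
    moreover have "- (q ^ (2 * i + Suc c)) \<noteq> - 1" for i
      using one_minus_power_nonzero[OF assms, of "2 * i + Suc c"] by auto
    ultimately show ?thesis
      using summable_imp_convergent_prod_complex[of "\<lambda>i. - (q ^ (2 * i + Suc c))"] by simp
  qed
  have nz: "1 - q ^ (2 * i + Suc c) \<noteq> 0" for i c
    by (intro one_minus_power_nonzero assms) simp
  show o: "(\<lambda>i. 1 - q ^ (2 * i + 1)) has_prod oddprodinf q"
    using conv[of 0] unfolding oddprodinf_def by (simp add: convergent_prod_has_prod)
  show e: "(\<lambda>i. 1 - q ^ (2 * i + 2)) has_prod evenprodinf q"
    using conv[of 1] unfolding evenprodinf_def by (simp add: convergent_prod_has_prod numeral_2_eq_2)
  show "oddprodinf q \<noteq> 0" using has_prod_eq_0_iff[OF o] nz[of _ 0] by auto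
  show "evenprodinf q \<noteq> 0" using has_prod_eq_0_iff[OF e] nz[of _ 1] by (auto simp: numeral_2_eq_2)
  show "oddprod q \<longlonglongrightarrow> oddprodinf q"
    using has_prod_imp_tendsto'[OF o] by (simp only: oddprod_def[abs_def])
  show "evenprod q \<longlonglongrightarrow> evenprodinf q"
    using has_prod_imp_tendsto'[OF e] by (simp only: evenprod_def[abs_def])
qed

section \<open>Absolutely convergent series and sums over the integers\<close>

lemma summable_mult_bounded:
  fixes c h :: "nat \<Rightarrow> complex"
  assumes c: "summable (\<lambda>n. norm (c n))" and h: "\<And>n. norm (h n) \<le> B"
  shows "summable (\<lambda>n. norm (c n * h n))"
  by (rule summable_comparison_test[OF _ summable_mult2[OF c, of B]])
     (auto simp: norm_mult intro!: exI[of _ 0] mult_left_mono h)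

text \<open>The integers are split into \<open>n\<close> and \<open>- 1 - n\<close> with
  \<open>n\<close> natural because this reflection negates \<open>2*n+1\<close>, the exponent in the
  denominators of \<open>kterm\<close>.\<close>

lemma
  fixes f :: "int \<Rightarrow> complex"
  assumes nonneg: "summable (\<lambda>n. norm (f (int n)))" and neg: "summable (\<lambda>n. norm (f (- 1 - int n)))"
  shows abs_summable_on_int: "(\<lambda>m. norm (f m)) summable_on UNIV"
    and infsum_int: "infsum f UNIV = (\<Sum>n. f (int n) + f (- 1 - int n))"
proof -
  have *: "(UNIV :: int set) = range int \<union> range (\<lambda>n. - 1 - int n)"
  proof (intro set_eqI iffI UnCI)
    fix m :: int assume "m \<notin> range (\<lambda>n. - 1 - int n)"
    then have "m \<noteq> - 1 - int (nat (- 1 - m))" by blast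
    then have "m = int (nat m)" by linarith
    then show "m \<in> range int" by blast
  qed auto
  have disj: "range int \<inter> range (\<lambda>n. - 1 - int n) = {}" by auto
  have inj: "inj int" "inj (\<lambda>n. - 1 - int n)" by (auto simp: inj_def)
  have "(\<lambda>m. norm (f m)) summable_on range int"
    unfolding summable_on_reindex[OF inj(1)] o_def
    by (rule norm_summable_imp_summable_on) (use nonneg in simp)
  moreover have "(\<lambda>m. norm (f m)) summable_on range (\<lambda>n. - 1 - int n)"
    unfolding summable_on_reindex[OF inj(2)] o_def
    by (rule norm_summable_imp_summable_on) (use neg in simp)
  ultimately show "(\<lambda>m. norm (f m)) summable_on UNIV"
    unfolding * by (rule summable_on_Un_disjoint[OF _ _ disj])
  have "(f has_sum (\<Sum>n. f (int n))) (range int)"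
    unfolding has_sum_reindex[OF inj(1)] o_def
    by (rule norm_summable_imp_has_sum[OF nonneg summable_sums[OF summable_norm_cancel[OF nonneg]]])
  moreover have "(f has_sum (\<Sum>n. f (- 1 - int n))) (range (\<lambda>n. - 1 - int n))"
    unfolding has_sum_reindex[OF inj(2)] o_def
    by (rule norm_summable_imp_has_sum[OF neg summable_sums[OF summable_norm_cancel[OF neg]]])
  ultimately have "(f has_sum ((\<Sum>n. f (int n)) + (\<Sum>n. f (- 1 - int n)))) UNIV"
    unfolding * by (rule has_sum_Un_disjoint[OF _ _ disj])
  then show "infsum f UNIV = (\<Sum>n. f (int n) + f (- 1 - int n))"
    using suminf_add[OF summable_norm_cancel[OF nonneg] summable_norm_cancel[OF neg]]
    by (simp add: infsumI)
qed

text \<open>The shear \<open>(d, m)\<close> to \<open>(m, m + d)\<close> is a bijection of pairs of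
  integers. Absolute summability of \<open>u m * u n\<close> over all pairs then permits summation
  along the diagonals.\<close>

lemma
  fixes u :: "int \<Rightarrow> complex"
  assumes u: "(\<lambda>m. norm (u m)) summable_on UNIV"
  shows summable_on_correlations: "(\<lambda>d. \<Sum>\<^sub>\<infinity>m. u m * u (m + d)) summable_on UNIV"
    and infsum_square: "(infsum u UNIV)\<^sup>2 = (\<Sum>\<^sub>\<infinity>d. \<Sum>\<^sub>\<infinity>m. u m * u (m + d))"
proof -
  have bij: "bij_betw (\<lambda>(d, m). (m, m + d)) (UNIV \<times> UNIV) (UNIV \<times> UNIV :: (int \<times> int) set)"
    by (rule bij_betw_byWitness[where f' = "\<lambda>(m, n). (n - m, m)"]) auto
  have "(\<lambda>p. norm (case p of (m, n) \<Rightarrow> u m * u n)) summable_on UNIV \<times> UNIV"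
    unfolding Infinite_Sum.abs_summable_on_Sigma_iff
    using u by (auto simp: norm_mult infsum_cmult_right' abs_mult infsum_nonneg intro: summable_on_cmult_right summable_on_cmult_left)
  then have prod: "(\<lambda>(m, n). u m * u n) summable_on UNIV \<times> UNIV"
    by (rule Infinite_Sum.abs_summable_summable)
  have eq: "(case (case p of (d, m) \<Rightarrow> (m, m + d)) of (m, n) \<Rightarrow> u m * u n) = (\<lambda>(d, m). u m * u (m + d)) p" for p
    by (cases p) auto
  have shifted: "(\<lambda>(d, m). u m * u (m + d)) summable_on UNIV \<times> UNIV"
    using prod unfolding summable_on_reindex_bij_betw[OF bij, of "\<lambda>(m, n). u m * u n", symmetric] eq .
  show "(\<lambda>d. \<Sum>\<^sub>\<infinity>m. u m * u (m + d)) summable_on UNIV"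
    by (rule summable_on_Sigma_banach[OF shifted])
  have "(infsum u UNIV)\<^sup>2 = (\<Sum>\<^sub>\<infinity>m. \<Sum>\<^sub>\<infinity>n. u m * u n)"
    by (simp add: power2_eq_square infsum_cmult_right' infsum_cmult_left')
  also have "\<dots> = (\<Sum>\<^sub>\<infinity>(m, n)\<in>UNIV \<times> UNIV. u m * u n)"
    by (rule infsum_Sigma'_banach[OF prod])
  also have "\<dots> = (\<Sum>\<^sub>\<infinity>(d, m)\<in>UNIV \<times> UNIV. u m * u (m + d))"
    unfolding infsum_reindex_bij_betw[OF bij, of "\<lambda>(m, n). u m * u n", symmetric] eq ..
  also have "\<dots> = (\<Sum>\<^sub>\<infinity>d. \<Sum>\<^sub>\<infinity>m. u m * u (m + d))"
    by (rule infsum_Sigma'_banach[OF shifted, symmetric])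
  finally show "(infsum u UNIV)\<^sup>2 = (\<Sum>\<^sub>\<infinity>d. \<Sum>\<^sub>\<infinity>m. u m * u (m + d))" .
qed

context
  fixes q :: complex
  assumes q0: "q \<noteq> 0" and q1: "norm q < 1"
begin

subsection \<open>The fourth power\<close>

text \<open>Each odd power is matched with a neighbouring even node: the one just below it on the
  side under \<open>n\<close>, the one just above it on the other side. All powers of
  \<open>q\<close> then cancel except one factor \<open>q\<close> for each of the \<open>n\<close>
  lower pairs.\<close>

lemma node_quotient:
  assumes "n \<le> M"
  shows "(\<Prod>i<M. q ^ (2*n) - q ^ (2*i+1)) / (\<Prod>i\<in>{..M}-{n}. q ^ (2*n) - q ^ (2*i)) =
         q ^ n * prodquot q n * prodquot q (M - n)"
proof -
  have num: "(\<Prod>i<M. q ^ (2*n) - q ^ (2*i+1)) =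
      (\<Prod>i<n. q ^ (2*n) - q ^ (2*(n - Suc i)+1)) * (\<Prod>i<M-n. q ^ (2*n) - q ^ (2*(n+i)+1))"
  proof -
    have "(\<Prod>i\<in>{n..<M}. q ^ (2*n) - q ^ (2*i+1)) = (\<Prod>i<M-n. q ^ (2*n) - q ^ (2*(n+i)+1))"
      by (rule prod.reindex_bij_witness[of _ "\<lambda>i. n + i" "\<lambda>i. i - n"]) auto
    moreover have "(\<Prod>i<n. q ^ (2*n) - q ^ (2*i+1)) = (\<Prod>i<n. q ^ (2*n) - q ^ (2*(n - Suc i)+1))"
      by (rule prod.nat_diff_reindex[symmetric])
    moreover have "{..<M} = {..<n} \<union> {n..<M}" using assms by auto
    then have "(\<Prod>i<M. q ^ (2*n) - q ^ (2*i+1)) =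
        (\<Prod>i<n. q ^ (2*n) - q ^ (2*i+1)) * (\<Prod>i\<in>{n..<M}. q ^ (2*n) - q ^ (2*i+1))"
      by (metis (no_types, lifting) finite_atLeastLessThan finite_lessThan ivl_disj_int_one(2) prod.union_disjoint)
    ultimately show ?thesis by (simp only:)
  qed
  have a: "(q ^ (2*n) - q ^ (2*(n - Suc i)+1)) / (q ^ (2*n) - q ^ (2*(n - Suc i))) =
       q * ((1 - q ^ (2*i+1)) / (1 - q ^ (2*i+2)))" if "i < n" for i
  proof -
    obtain j where j: "n = Suc (i + j)" using less_imp_Suc_add[OF \<open>i < n\<close>] by auto
    have e: "q ^ (2*n) - q ^ (2*(n - Suc i)+1) = - (q ^ (2*j) * (q * (1 - q ^ (2*i+1))))"
      "q ^ (2*n) - q ^ (2*(n - Suc i)) = - (q ^ (2*j) * (1 - q ^ (2*i+2)))"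
      using j by (simp_all add: algebra_simps power_add)
    show ?thesis unfolding e using q0 by simp
  qed
  have b: "(q ^ (2*n) - q ^ (2*(n+i)+1)) / (q ^ (2*n) - q ^ (2*Suc (n+i))) =
       (1 - q ^ (2*i+1)) / (1 - q ^ (2*i+2))" for i
  proof -
    have e: "q ^ (2*n) - q ^ (2*(n+i)+1) = q ^ (2*n) * (1 - q ^ (2*i+1))"
      "q ^ (2*n) - q ^ (2*Suc (n+i)) = q ^ (2*n) * (1 - q ^ (2*i+2))"
      by (simp_all add: algebra_simps power_add)
    show ?thesis unfolding e using q0 by simp
  qed
  have a': "(\<Prod>i<n. q ^ (2*n) - q ^ (2*(n - Suc i)+1)) / (\<Prod>i<n. q ^ (2*n) - q ^ (2*(n - Suc i)))
      = q ^ n * prodquot q n"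
  proof -
    have "(\<Prod>i<n. (q ^ (2*n) - q ^ (2*(n - Suc i)+1)) / (q ^ (2*n) - q ^ (2*(n - Suc i)))) =
        (\<Prod>i<n. q * ((1 - q ^ (2*i+1)) / (1 - q ^ (2*i+2))))"
      by (intro prod.cong refl a) auto
    then show ?thesis
      by (simp only: prod_dividef prod.distrib prodquot_def oddprod_def evenprod_def prod_constant card_lessThan)
  qed
  show ?thesis
    unfolding num prod_split_at(2)[OF assms] times_divide_times_eq[symmetric] a'
    by (simp only: prod_dividef[symmetric] b mult.assoc prodquot_def oddprod_def evenprod_def)
qed

text \<open>The point of evaluation is the odd power whose factor has been left out. The lower pairs
  contribute \<open>q ^ N\<close>, the even node at \<open>N\<close> contributes
  \<open>q ^ (2*N)\<close> below the line, and above \<open>N\<close> there is one more even node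
  than odd powers, which leaves one \<open>q ^ (2*N+1)\<close>. Together this is
  \<open>q ^ (3*N+1)\<close> in the denominator.\<close>

lemma centre_quotient:
  fixes K defines "N \<equiv> Suc K"
  shows "(\<Prod>i\<in>{..2*N-1}-{N}. q ^ (2*N+1) - q ^ (2*i+1)) / (\<Prod>i\<le>2*N. q ^ (2*N+1) - q ^ (2*i)) =
         - (evenprod q N * evenprod q K / (oddprod q (Suc N) * oddprod q N)) / q ^ (3*N+1)"
proof -
  let ?w = "q ^ (2*N+1)"
  have a: "(?w - q ^ (2*(N - Suc i)+1)) / (?w - q ^ (2*(N - Suc i))) =
       q * ((1 - q ^ (2*i+2)) / (1 - q ^ (2*i+3)))" if "i < N" for i
  proof -
    obtain j where j: "N = Suc (i + j)" using less_imp_Suc_add[OF \<open>i < N\<close>] by auto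
    have e: "?w - q ^ (2*(N - Suc i)+1) = - (q ^ (2*j) * (q * (1 - q ^ (2*i+2))))"
      "?w - q ^ (2*(N - Suc i)) = - (q ^ (2*j) * (1 - q ^ (2*i+3)))"
      unfolding j by (simp_all add: algebra_simps power_add power2_eq_square power3_eq_cube)
    show ?thesis unfolding e using q0 by simp
  qed
  have b: "?w - q ^ (2*Suc (N+i)+1) = ?w * (1 - q ^ (2*i+2))" for i
    by (simp add: algebra_simps power_add)
  have c: "?w - q ^ (2*Suc (N+i)) = ?w * (1 - q ^ (2*i+1))" for i
    by (simp add: algebra_simps power_add)
  have d: "?w - q ^ (2*N) = - (q ^ (2*N) * (1 - q))"
    by (simp add: algebra_simps)
  have odd: "oddprod q (Suc N) = (1 - q) * (\<Prod>i<N. 1 - q ^ (2*i+3))"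
    unfolding oddprod_def by (subst prod.lessThan_Suc_shift) (simp add: numeral_3_eq_3)
  have s1: "(\<Prod>i\<in>{..2*N-1}-{N}. ?w - q ^ (2*i+1)) =
     (\<Prod>i<N. ?w - q ^ (2*(N - Suc i)+1)) * (\<Prod>i<K. ?w - q ^ (2*Suc (N+i)+1))"
    by (subst prod_split_at(2)) (auto simp: N_def)
  have s2: "(\<Prod>i\<le>2*N. ?w - q ^ (2*i)) =
     (\<Prod>i<N. ?w - q ^ (2*(N - Suc i))) * ((?w - q ^ (2*N)) * (\<Prod>i<N. ?w - q ^ (2*Suc (N+i))))"
    by (subst prod_split_at(1)[of N]) auto
  have s3: "(\<Prod>i<K. ?w - q ^ (2*Suc (N+i)+1)) = ?w ^ K * evenprod q K"
    unfolding b by (simp add: prod.distrib evenprod_def)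
  have s4: "(\<Prod>i<N. ?w - q ^ (2*Suc (N+i))) = ?w ^ Suc K * oddprod q N"
    unfolding c by (simp add: prod.distrib oddprod_def N_def)
  have s5: "(\<Prod>i<N. ?w - q ^ (2*(N - Suc i)+1)) / (\<Prod>i<N. ?w - q ^ (2*(N - Suc i)))
     = q ^ N * (evenprod q N / (\<Prod>i<N. 1 - q ^ (2*i+3)))"
  proof -
    have "(\<Prod>i<N. (?w - q ^ (2*(N - Suc i)+1)) / (?w - q ^ (2*(N - Suc i)))) =
        (\<Prod>i<N. q * ((1 - q ^ (2*i+2)) / (1 - q ^ (2*i+3))))"
      by (intro prod.cong refl a) auto
    then show ?thesis
      by (simp only: prod_dividef prod.distrib evenprod_def prod_constant card_lessThan)
  qed
  have "?w ^ K * evenprod q K / (- (q ^ (2*N) * (1 - q)) * (?w ^ Suc K * oddprod q N))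
     = - (evenprod q K / ((1 - q) * oddprod q N)) / (q ^ (2*N) * ?w)"
  proof -
    have "W ^ K * e / (- (a * c) * (W ^ Suc K * d)) = - (e / (c * d)) / (a * W)"
      if "W \<noteq> 0" for W a c d e :: complex
      using that by (cases "a = 0"; cases "c = 0"; cases "d = 0") (simp_all add: field_simps)
    then show ?thesis using q0 by simp
  qed
  moreover have "q ^ (2*N) * ?w = q ^ N * q ^ (3*N+1)"
    by (simp flip: power_add)
  moreover have "a * (e / b) * (- (f / (c * d)) / (a * g)) = - (e * f / ((c * b) * d)) / g"
    if "a \<noteq> 0" for a b c d e f g :: complex
    using that by simp
  ultimately show ?thesis
    using q0
    by (simp only: s1 s2 s3 s4 s5 d odd power_not_zero not_False_eq_True flip: times_divide_times_eq)
qed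

text \<open>This is the partial fraction expansion at \<open>q ^ (2*N+1)\<close> with even powers as
  nodes. Restoring the omitted factor at a node costs a second division by the distance between node
  and point, which produces the squared denominators. The two sums collect the nodes up to
  \<open>N\<close> and those above it.\<close>

lemma finite_four_triangular:
  fixes K defines "N \<equiv> Suc K"
  shows "(\<Sum>k\<le>N. q ^ (3*k+1) / (1 - q ^ (2*k+1))\<^sup>2 * (prodquot q (N - k) * prodquot q (N + k)))
       + (\<Sum>i<N. q ^ i / (1 - q ^ (2*i+1))\<^sup>2 * (prodquot q (Suc (N + i)) * prodquot q (N - Suc i)))
       = evenprod q N * evenprod q K / (oddprod q (Suc N) * oddprod q N)"
proof -
  let ?w = "q ^ (2*N+1)"
  \<comment> \<open>The factor with \<open>i = N\<close> is left out, so that both sides of the partial fraction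
    expansion stay finite at the point \<open>?w\<close>.\<close>
  define p where "p = (\<Prod>i\<in>{..2*N-1}-{N}. [:- (q ^ (2*i+1)), 1:])"
  have poly_p: "poly p x = (\<Prod>i\<in>{..2*N-1}-{N}. x - q ^ (2*i+1))" for x
    by (simp add: p_def poly_prod)
  have deg: "degree p \<le> 2*N"
  proof -
    have "degree p \<le> (\<Sum>i\<in>{..2*N-1}-{N}. degree [:- (q ^ (2*i+1)), 1:])"
      unfolding p_def by (rule order.trans[OF degree_prod_sum_le]) (auto simp: o_def)
    also have "\<dots> \<le> 2*N" by (simp add: N_def)
    finally show ?thesis .
  qed
  have inj: "inj_on (\<lambda>i. q ^ (2*i)) {..2*N}"
    using power_eq_iff_norm_less_one[OF q1 q0] by (auto simp: inj_on_def)
  have odd_even: "?w \<noteq> q ^ (2*n)" for n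
    unfolding power_eq_iff_norm_less_one[OF q1 q0] by presburger
  have cancel: "c * (d * r * s / (- (a * b))\<^sup>2) = e / b\<^sup>2 * (r * s)"
    "c * (d * r * s / (a * b)\<^sup>2) = e / b\<^sup>2 * (r * s)"
    if "c * d = e * a\<^sup>2" "a \<noteq> 0" for a b c d e r s :: complex
  proof -
    have "c * (d * r * s / (a * b)\<^sup>2) = (c * d) * (r * s) / (a * b)\<^sup>2" by simp
    also have "\<dots> = e / b\<^sup>2 * (r * s)" using that by (simp add: power_mult_distrib)
    finally show "c * (d * r * s / (a * b)\<^sup>2) = e / b\<^sup>2 * (r * s)" .
    then show "c * (d * r * s / (- (a * b))\<^sup>2) = e / b\<^sup>2 * (r * s)" by simp
  qed
  \<comment> \<open>The factor \<open>q ^ (3*N+1)\<close> clears the denominator from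
    \<open>centre_quotient\<close>. It also makes the weights independent of \<open>N\<close> once
    the index is counted from \<open>N\<close>.\<close>
  define T where "T n = q ^ (3*N+1) * (q ^ n * prodquot q n * prodquot q (2*N - n) / (?w - q ^ (2*n))\<^sup>2)" for n
  have summand: "poly p (q ^ (2*n)) / ((?w - q ^ (2*n)) * (\<Prod>i\<in>{..2*N}-{n}. q ^ (2*n) - q ^ (2*i)))
     = - T n / q ^ (3*N+1)" if "n \<le> 2*N" for n
  proof -
    have "{..2*N-1} = {..<2*N}" by (auto simp: N_def)
    then have "(\<Prod>i<2*N. q ^ (2*n) - q ^ (2*i+1)) = (q ^ (2*n) - ?w) * poly p (q ^ (2*n))"
      unfolding poly_p by (subst prod.remove[of _ N]) (auto simp: N_def)
    with odd_even[of n] have *: "poly p (q ^ (2*n)) = - ((\<Prod>i<2*N. q ^ (2*n) - q ^ (2*i+1)) / (?w - q ^ (2*n)))"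
      by (simp add: field_simps)
    show ?thesis unfolding * T_def node_quotient[OF that, symmetric]
      using q0 by (simp add: power2_eq_square)
  qed
  have "poly p ?w / (\<Prod>i\<le>2*N. ?w - q ^ (2*i)) = (\<Sum>n\<le>2*N. - T n / q ^ (3*N+1))"
    using summand by (subst Lagrange_partial_fractions[OF inj deg]) (use odd_even in \<open>auto intro!: sum.cong simp del: power_Suc\<close>)
  then have "(\<Sum>n\<le>2*N. T n) = evenprod q N * evenprod q K / (oddprod q (Suc N) * oddprod q N)"
    unfolding poly_p centre_quotient[of K, folded N_def] using q0
    by (simp add: sum_negf flip: sum_divide_distrib divide_divide_eq_left)
  moreover have "T (N - k) = q ^ (3*k+1) / (1 - q ^ (2*k+1))\<^sup>2 * (prodquot q (N - k) * prodquot q (N + k))"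
    if "k \<le> N" for k
  proof -
    obtain j where j: "N = j + k" using \<open>k \<le> N\<close> by (metis le_add_diff_inverse2)
    have w: "?w - q ^ (2*(N-k)) = - (q ^ (2*j) * (1 - q ^ (2*k+1)))"
      unfolding j by (simp add: algebra_simps power_add)
    have pow: "q ^ (3*N+1) * q ^ (N - k) = q ^ (3*k+1) * (q ^ (2*j))\<^sup>2"
      unfolding j by (simp add: algebra_simps flip: power_add power_mult)
    have idx: "2*N - (N - k) = N + k" using j by simp
    show ?thesis unfolding T_def w idx by (rule cancel[OF pow]) (use q0 in simp)
  qed
  moreover have "T (Suc (N + i)) = q ^ i / (1 - q ^ (2*i+1))\<^sup>2 * (prodquot q (Suc (N + i)) * prodquot q (N - Suc i))"
    if "i < N" for i
  proof -
    have w: "?w - q ^ (2*Suc (N + i)) = ?w * (1 - q ^ (2*i+1))"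
      by (simp add: algebra_simps power_add)
    have pow: "q ^ (3*N+1) * q ^ Suc (N + i) = q ^ i * ?w\<^sup>2"
      by (simp add: algebra_simps flip: power_add power_mult)
    have idx: "2*N - Suc (N + i) = N - Suc i" by simp
    show ?thesis unfolding T_def w idx by (rule cancel[OF pow]) (use q0 in simp)
  qed
  ultimately show ?thesis unfolding sum_split_at by simp
qed

text \<open>As \<open>N\<close> grows, the two quotients in each term tend to (O/E)^2 while the
  closed form tends to (E/O)^2. Hence the sum of the weights is (E/O)^4.\<close>

lemma four_triangular_sums:
  "(\<lambda>n. q ^ n * (1 + q ^ (2*n+1)) / (1 - q ^ (2*n+1))\<^sup>2) sums ((evenprodinf q / oddprodinf q) ^ 4)"
proof -
  let ?r = "prodquot q" and ?E = "evenprodinf q" and ?O = "oddprodinf q"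
  define c1 where "c1 k = q ^ (3*k+1) / (1 - q ^ (2*k+1))\<^sup>2" for k
  define c2 where "c2 k = q ^ k / (1 - q ^ (2*k+1))\<^sup>2" for k
  have r_lim: "?r \<longlonglongrightarrow> ?O / ?E"
    unfolding prodquot_def[abs_def]
    by (intro tendsto_divide LIMSEQ_oddprod LIMSEQ_evenprod q1 evenprodinf_nonzero)
  then obtain B where B: "\<And>n. norm (?r n) \<le> B"
    using Bseq_def convergentI[THEN convergent_imp_Bseq] by blast
  have B0: "B \<ge> 0" using B[of 0] norm_ge_zero order.trans by blast
  have d: "1 - norm q > 0" using q1 by simp
  have sq: "norm (1 / (1 - q ^ (2*k+1))\<^sup>2) \<le> 1 / (1 - norm q)\<^sup>2" for k
    using d norm_one_minus_power_ge[OF q1, of "2*k+1"]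
    by (auto simp: norm_divide norm_power intro!: divide_left_mono power_mono mult_pos_pos simp del: power_Suc)
  have c: "summable (\<lambda>k. norm (q ^ m k / (1 - q ^ (2*k+1))\<^sup>2))" if m: "\<And>k. m k \<ge> k" for m
  proof (rule summable_power_comparison[OF q1])
    fix k
    have "norm (q ^ m k) \<le> norm q ^ k"
      using q1 m by (auto simp: norm_power intro: power_decreasing)
    then have "norm (q ^ m k) * norm (1 / (1 - q ^ (2*k+1))\<^sup>2) \<le> norm q ^ k * (1 / (1 - norm q)\<^sup>2)"
      by (intro mult_mono sq) auto
    then show "norm (q ^ m k / (1 - q ^ (2*k+1))\<^sup>2) \<le> (1 / (1 - norm q)\<^sup>2) * norm q ^ k"
      by (simp add: norm_divide)
  qed
  have c1: "summable (\<lambda>k. norm (c1 k))" and c2: "summable (\<lambda>k. norm (c2 k))"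
    unfolding c1_def c2_def by (intro c; simp)+
  have shift: "filterlim (\<lambda>N. N - m) at_top sequentially" "filterlim (\<lambda>N. N + m) at_top sequentially" for m :: nat
    by (rule filterlim_minus_const_nat_at_top filterlim_add_const_nat_at_top)+
  have lim_r: "(\<lambda>N. ?r (N - m) * ?r (N + n)) \<longlonglongrightarrow> (?O / ?E) * (?O / ?E)" for m n
    by (intro tendsto_mult filterlim_compose[OF r_lim] shift)
  have "(\<lambda>N. \<Sum>k<Suc N. c1 k * (?r (N - k) * ?r (N + k))) \<longlonglongrightarrow> (\<Sum>k. c1 k) * ((?O / ?E) * (?O / ?E))"
    by (rule tannery_weighted_sums[where B = "B * B"])
       (use lim_r[of k k for k] in \<open>auto simp: norm_mult B0 intro!: c1 mult_mono B filterlim_Suc\<close>)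
  moreover have "(\<lambda>N. \<Sum>k<N. c2 k * (?r (Suc (N + k)) * ?r (N - Suc k))) \<longlonglongrightarrow> (\<Sum>k. c2 k) * ((?O / ?E) * (?O / ?E))"
    by (rule tannery_weighted_sums[where B = "B * B"])
       (use lim_r[of "Suc k" "Suc k" for k] in \<open>auto simp: norm_mult B0 mult.commute intro!: c2 mult_mono B filterlim_ident\<close>)
  ultimately have "(\<lambda>N. (\<Sum>k<Suc N. c1 k * (?r (N - k) * ?r (N + k))) + (\<Sum>k<N. c2 k * (?r (Suc (N + k)) * ?r (N - Suc k))))
      \<longlonglongrightarrow> (\<Sum>k. c1 k) * ((?O / ?E) * (?O / ?E)) + (\<Sum>k. c2 k) * ((?O / ?E) * (?O / ?E))" (is "?F \<longlonglongrightarrow> ?L")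
    by (rule tendsto_add)
  \<comment> \<open>The finite identity is available for \<open>N = Suc K\<close>, so the sequence
    is shifted by one.\<close>
  then have "(\<lambda>K. ?F (Suc K)) \<longlonglongrightarrow> ?L" by (rule LIMSEQ_Suc)
  moreover have "?F (Suc K) = evenprod q (Suc K) * evenprod q K / (oddprod q (Suc (Suc K)) * oddprod q (Suc K))" for K
    unfolding finite_four_triangular[symmetric] c1_def c2_def lessThan_Suc_atMost ..
  moreover have "(\<lambda>K. evenprod q (Suc K) * evenprod q K / (oddprod q (Suc (Suc K)) * oddprod q (Suc K)))
      \<longlonglongrightarrow> ?E * ?E / (?O * ?O)"
    by (intro tendsto_intros LIMSEQ_Suc LIMSEQ_oddprod LIMSEQ_evenprod q1)
       (auto simp: oddprodinf_nonzero q1)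
  ultimately have "?L = ?E * ?E / (?O * ?O)"
    by (intro LIMSEQ_unique) (simp_all only:)
  then have "(\<Sum>k. c1 k) + (\<Sum>k. c2 k) = (?E / ?O) ^ 4"
    using oddprodinf_nonzero[OF q1] evenprodinf_nonzero[OF q1]
    by (simp add: field_simps power4_eq_xxxx)
  moreover have "(\<lambda>k. c1 k + c2 k) sums ((\<Sum>k. c1 k) + (\<Sum>k. c2 k))"
    by (rule sums_add[OF summable_sums[OF summable_norm_cancel[OF c1]] summable_sums[OF summable_norm_cancel[OF c2]]])
  moreover have "c1 k + c2 k = q ^ k * (1 + q ^ (2*k+1)) / (1 - q ^ (2*k+1))\<^sup>2" for k
  proof -
    have "q ^ (3*k+1) + q ^ k = q ^ k * (1 + q ^ (2*k+1))"
      by (simp add: algebra_simps flip: power_add)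
    then show ?thesis unfolding c1_def c2_def by (simp only: flip: add_divide_distrib)
  qed
  ultimately show ?thesis by simp
qed

subsection \<open>The square of Kronecker's series\<close>

text \<open>Summing over all \<open>n\<close> gives a case of Kronecker's bilateral series. The terms with indices
  \<open>n\<close> and \<open>- 1 - n\<close> cancel at \<open>y = 1\<close>.\<close>
definition kterm :: "complex \<Rightarrow> int \<Rightarrow> complex" where
  "kterm y n = q powi n / (1 - q powi (2*n+1) * y)"

text \<open>The poles of the terms \<open>kterm y n\<close> in \<open>y\<close> are the odd powers
  of \<open>q\<close>, with exponents of both signs. Those nearest to the unit circle are
  \<open>q\<close> and its inverse, and the annulus lies strictly between their moduli.\<close>

definition qannulus :: "complex set" where
  "qannulus = {y. norm q < norm y \<and> norm q * norm y < 1}"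

lemma one_in_qannulus: "1 \<in> qannulus"
  using q1 by (simp add: qannulus_def)

lemma
  assumes y: "y \<in> qannulus"
  shows norm_one_minus_mult_ge: "norm (1 - q ^ (2*n+1) * y) \<ge> 1 - norm q * norm y"
    and norm_minus_power_ge: "norm (y - q ^ (2*n+1)) \<ge> norm y - norm q"
    and one_minus_mult_nonzero: "1 - q ^ (2*n+1) * y \<noteq> 0"
    and minus_power_nonzero: "y - q ^ (2*n+1) \<noteq> 0"
proof -
  have "norm q ^ (2*n+1) \<le> norm q ^ 1" using q1 by (intro power_decreasing) auto
  then have x: "norm (q ^ (2*n+1)) \<le> norm q" by (simp add: norm_power norm_mult)
  then have "norm (q ^ (2*n+1) * y) \<le> norm q * norm y"
    unfolding norm_mult by (intro mult_right_mono) auto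
  then show 1: "norm (1 - q ^ (2*n+1) * y) \<ge> 1 - norm q * norm y"
    using norm_triangle_ineq2[of 1 "q ^ (2*n+1) * y"] by simp
  show 2: "norm (y - q ^ (2*n+1)) \<ge> norm y - norm q"
    using norm_triangle_ineq2[of y "q ^ (2*n+1)"] x by simp
  show "1 - q ^ (2*n+1) * y \<noteq> 0" using 1 y by (force simp: qannulus_def)
  show "y - q ^ (2*n+1) \<noteq> 0" using 2 y by (force simp: qannulus_def)
qed

section \<open>Denominators at nonnegative and negative indices\<close>

lemma power_int_neg: "q powi (- 1 - int n) * q ^ (2*n+1) = q ^ n" "q powi (2 * (- 1 - int n) + 1) * q ^ (2*n+1) = 1"
proof -
  have "q powi k * q ^ (2*n+1) = q powi (k + int (2*n+1))" for k
    using q0 by (subst power_int_add) (auto simp only: power_int_of_nat)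
  from this[of "- 1 - int n"] this[of "2 * (- 1 - int n) + 1"]
  show "q powi (- 1 - int n) * q ^ (2*n+1) = q ^ n" "q powi (2 * (- 1 - int n) + 1) * q ^ (2*n+1) = 1"
    by (simp_all only:) (simp_all add: algebra_simps)
qed

lemma power_int_odd: "q powi (2 * int n + 1) = q ^ (2*n+1)"
proof -
  have "2 * int n + 1 = int (2*n+1)" by simp
  then show ?thesis by (simp only: power_int_of_nat)
qed

lemma kterm_nonneg: "kterm y (int n) = q ^ n / (1 - q ^ (2*n+1) * y)"
  unfolding kterm_def power_int_odd by simp

lemma
  assumes y: "y \<in> qannulus"
  shows neg_denominator: "1 - q powi (2 * (- 1 - int n) + 1) * y = - (y - q ^ (2*n+1)) / q ^ (2*n+1)"
    and kterm_neg: "kterm y (- 1 - int n) = - (q ^ n / (y - q ^ (2*n+1)))"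
proof -
  have nz: "q ^ (2*n+1) \<noteq> 0" using q0 by simp
  show den: "1 - q powi (2 * (- 1 - int n) + 1) * y = - (y - q ^ (2*n+1)) / q ^ (2*n+1)"
    using power_int_neg(2)[of n] nz by (simp add: field_simps del: power_Suc)
  show "kterm y (- 1 - int n) = - (q ^ n / (y - q ^ (2*n+1)))"
  proof -
    have "a / (- b / w) = - (a * w / b)" for a b w :: complex by simp
    then show ?thesis unfolding kterm_def den power_int_neg(1)[of n, symmetric] .
  qed
qed

lemma kterm_denominator_nonzero:
  assumes y: "y \<in> qannulus"
  shows "1 - q powi (2*m+1) * y \<noteq> 0"
proof (cases "m \<ge> 0")
  case True
  then show ?thesis
    using one_minus_mult_nonzero[OF y, of "nat m"] power_int_odd[of "nat m"] by simp
next
  case False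
  then have "m = - 1 - int (nat (- 1 - m))" by simp
  then show ?thesis
    using neg_denominator[OF y, of "nat (- 1 - m)"] minus_power_nonzero[OF y] q0
    by (metis divide_eq_0_iff neg_equal_0_iff_equal power_not_zero)
qed

text \<open>Up to sign and a power of \<open>q\<close>, this is the product of the denominators of
  \<open>kterm y\<close> at \<open>n\<close> and \<open>- 1 - n\<close>. At \<open>y = 1\<close> it
  becomes \<open>(1 - q ^ (2*n+1))\<close> squared.\<close>

definition pairden :: "complex \<Rightarrow> nat \<Rightarrow> complex" where
  "pairden y n = (1 - q ^ (2*n+1) * y) * (y - q ^ (2*n+1))"

section \<open>Uniform bounds and the paired form of the series\<close>

lemma
  assumes y: "y \<in> qannulus"
  shows norm_inverse_one_minus_le: "norm (inverse (1 - q ^ (2*n+1) * y)) \<le> inverse (1 - norm q * norm y)"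
    and norm_inverse_minus_le: "norm (inverse (y - q ^ (2*n+1))) \<le> inverse (norm y - norm q)"
    and norm_inverse_pairden_le:
      "norm (inverse (pairden y n)) \<le> inverse (1 - norm q * norm y) * inverse (norm y - norm q)"
proof -
  have pos: "0 < 1 - norm q * norm y" "0 < norm y - norm q" using y by (auto simp: qannulus_def)
  show 1: "norm (inverse (1 - q ^ (2*n+1) * y)) \<le> inverse (1 - norm q * norm y)"
    unfolding norm_inverse by (intro le_imp_inverse_le norm_one_minus_mult_ge y pos)
  show 2: "norm (inverse (y - q ^ (2*n+1))) \<le> inverse (norm y - norm q)"
    unfolding norm_inverse by (intro le_imp_inverse_le norm_minus_power_ge y pos)
  show "norm (inverse (pairden y n)) \<le> inverse (1 - norm q * norm y) * inverse (norm y - norm q)"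
    unfolding pairden_def inverse_mult_distrib norm_mult using pos
    by (intro mult_mono 1 2) auto
qed

lemma norm_inverse_pairden_sq_le:
  assumes "y \<in> qannulus"
  shows "norm (y * (inverse (pairden y n))\<^sup>2) \<le>
    norm y * (inverse (1 - norm q * norm y) * inverse (norm y - norm q))\<^sup>2"
  unfolding norm_mult norm_power by (intro mult_left_mono power_mono norm_inverse_pairden_le assms) auto

lemma summable_norm_power: "(\<And>n. m n \<ge> n) \<Longrightarrow> summable (\<lambda>n. norm (q ^ m n))"
  by (rule summable_power_comparison[OF q1, where C = 1])
     (use q1 in \<open>auto simp: norm_power intro: power_decreasing\<close>)

lemma norm_one_plus_power_le: "norm (1 + q ^ n) \<le> 2"
  using norm_triangle_ineq[of 1 "q ^ n"] q1 power_le_one[of "norm q" n] by (simp add: norm_power)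

lemma summable_norm_pair: "summable (\<lambda>n. norm (q ^ n * (1 + q ^ (2*n+1))))"
  by (rule summable_mult_bounded[OF summable_norm_power norm_one_plus_power_le]) simp

lemma summable_norm_mult_square: "summable (\<lambda>n. norm (q ^ (2*n+1) * (1 + q ^ (2*n+1))\<^sup>2))"
  by (rule summable_mult_bounded[OF summable_norm_power, of _ _ "2\<^sup>2"])
     (auto simp only: norm_power intro!: power_mono norm_one_plus_power_le, auto)

lemma summable_norm_div_square: "summable (\<lambda>n. norm (2 * (q ^ (2*n+1))\<^sup>2 / (1 - q ^ (2*n+1))\<^sup>2))"
proof -
  have "summable (\<lambda>n. norm (q ^ (2*(2*n+1)) * (2 * (inverse (1 - q ^ (2*n+1)))\<^sup>2)))"
  proof (rule summable_mult_bounded[OF summable_norm_power])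
    show "norm (2 * (inverse (1 - q ^ (2*n+1)))\<^sup>2) \<le> 2 * (inverse (1 - norm q))\<^sup>2" for n
      using power_mono[OF norm_inverse_minus_le[OF one_in_qannulus, of n], of 2]
      by (simp add: norm_mult norm_power del: power_Suc)
  qed simp
  moreover have "q ^ (2*(2*n+1)) * (2 * (inverse (1 - q ^ (2*n+1)))\<^sup>2) = 2 * (q ^ (2*n+1))\<^sup>2 / (1 - q ^ (2*n+1))\<^sup>2" for n
    by (simp only: divide_inverse power_inverse power_mult[symmetric] mult_ac)
  ultimately show ?thesis by simp
qed

lemma
  assumes y: "y \<in> qannulus"
  shows abs_summable_kterm: "(\<lambda>m. norm (kterm y m)) summable_on UNIV"
    and infsum_kterm: "infsum (kterm y) UNIV =
      (y - 1) * (\<Sum>n. q ^ n * (1 + q ^ (2*n+1)) * inverse (pairden y n))"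
proof -
  let ?p = "\<lambda>n. q ^ n * (1 + q ^ (2*n+1)) * inverse (pairden y n)"
  have nonneg: "summable (\<lambda>n. norm (kterm y (int n)))"
    unfolding kterm_nonneg divide_inverse
    by (rule summable_mult_bounded[OF summable_norm_power norm_inverse_one_minus_le[OF y]]) simp
  have neg: "summable (\<lambda>n. norm (kterm y (- 1 - int n)))"
    unfolding kterm_neg[OF y] norm_minus_cancel divide_inverse
    by (rule summable_mult_bounded[OF summable_norm_power norm_inverse_minus_le[OF y]]) simp
  show "(\<lambda>m. norm (kterm y m)) summable_on UNIV" by (rule abs_summable_on_int[OF nonneg neg])
  \<comment> \<open>Pairing exposes the zero at \<open>y = 1\<close>: every pair carries the factor
    \<open>y - 1\<close>. The remaining series at \<open>y = 1\<close> is the one evaluated by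
    \<open>four_triangular_sums\<close>.\<close>
  have pair: "kterm y (int n) + kterm y (- 1 - int n) = (y - 1) * ?p n" for n
  proof -
    have "a / (1 - x * y) - a / (y - x) = (y - 1) * (a * (1 + x) / ((1 - x * y) * (y - x)))"
      if "1 - x * y \<noteq> 0" "y - x \<noteq> 0" for a x
    proof -
      have "a / (1 - x * y) - a / (y - x) = (a * (y - x) - a * (1 - x * y)) / ((1 - x * y) * (y - x))"
        using that by (rule diff_frac_eq)
      also have "a * (y - x) - a * (1 - x * y) = (y - 1) * (a * (1 + x))" by (simp add: algebra_simps)
      finally show ?thesis by simp
    qed
    from this[OF one_minus_mult_nonzero[OF y, of n] minus_power_nonzero[OF y, of n]]
    show ?thesis unfolding kterm_nonneg kterm_neg[OF y] pairden_def
      by (simp only: diff_conv_add_uminus divide_inverse)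
  qed
  have p: "summable ?p"
    by (rule summable_norm_cancel[OF summable_mult_bounded[OF summable_norm_pair norm_inverse_pairden_le[OF y]]])
  show "infsum (kterm y) UNIV = (y - 1) * suminf ?p"
    unfolding infsum_int[OF nonneg neg] pair by (rule suminf_mult[OF p])
qed

text \<open>The sum over \<open>m\<close> is just \<open>- d\<close>, but all that matters is that no \<open>y\<close> occurs here.\<close>
definition correlation_const :: "int \<Rightarrow> complex" where
  "correlation_const d = q powi d / (1 - q powi (2*d)) * (\<Sum>\<^sub>\<infinity>m. of_bool (m + d < 0) - of_bool (m < 0))"

text \<open>Since \<open>z (m + d)\<close> is \<open>z m\<close> times \<open>q powi (2*d)\<close>,
  partial fractions turn the product into a constant times \<open>phi m - phi (m + d)\<close>. Its
  sum over \<open>m\<close> depends only on the limits of \<open>phi\<close> at both ends, which are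
  0 and -1 for every \<open>y\<close>.\<close>

lemma kterm_correlation:
  assumes y: "y \<in> qannulus" and d: "d \<noteq> 0"
  shows "q * y * (\<Sum>\<^sub>\<infinity>m. kterm y m * kterm y (m + d)) = correlation_const d"
proof -
  define z where "z m = q powi (2*m+1) * y" for m
  define phi where "phi m = z m / (1 - z m)" for m
  \<comment> \<open>\<open>phi\<close> tends to \<open>-1\<close> at minus infinity; correcting it there makes it summable, so that
    its differences telescope to \<open>0\<close> by shift invariance.\<close>
  define chi where "chi m = phi m + of_bool (m < 0)" for m
  \<comment> \<open>This is the contribution of the correction term in \<open>chi\<close> to the
    difference; it has finite support between 0 and \<open>- d\<close>.\<close>
  define K :: "int \<Rightarrow> complex" where "K m = of_bool (m + d < 0) - of_bool (m < 0)" for m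
  have den: "1 - z m \<noteq> 0" for m
    unfolding z_def by (rule kterm_denominator_nonzero[OF y])
  have t1: "q powi (2*d) \<noteq> 1"
  proof
    assume "q powi (2*d) = 1"
    then have "q ^ nat \<bar>2*d\<bar> = 1"
      using d by (cases "d > 0") (auto simp: power_int_def power_inverse)
    then show False using d one_minus_power_nonzero[OF q1, of "nat \<bar>2*d\<bar>"] by simp
  qed
  have pf: "q * y * (kterm y m * kterm y (m + d)) = q powi d / (1 - q powi (2*d)) * (phi m - phi (m + d))" for m
  proof -
    define t where "t = q powi d"
    have "q powi (2*d) = t * t" using q0 by (simp add: t_def flip: power_int_add)
    moreover have "z (m + d) = z m * (t * t)"
      using q0 by (simp add: z_def t_def algebra_simps flip: power_int_add)
    moreover have "q * y * (q powi m * q powi (m + d)) = z m * t"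
    proof -
      have "q powi (2*m) = q powi m * q powi m" using q0 by (simp flip: power_int_add)
      then have "q powi (2*m+1) = q * (q powi m * q powi m)" using q0 by (simp add: power_int_add)
      then show ?thesis unfolding z_def t_def using q0 by (simp add: power_int_add)
    qed
    moreover have "phi m - phi (m + d) = (z m - z (m + d)) / ((1 - z m) * (1 - z (m + d)))"
      unfolding phi_def using den[of m] den[of "m + d"] by (simp add: divide_simps) (simp add: algebra_simps)
    moreover have "q * y * (kterm y m * kterm y (m + d)) =
        q * y * (q powi m * q powi (m + d)) / ((1 - z m) * (1 - z (m + d)))"
      by (simp add: kterm_def z_def)
    moreover have "z m * t / D = t / (1 - t * t) * ((z m - z m * (t * t)) / D)" for D
    proof -
      have "1 - t * t \<noteq> 0" using t1 \<open>q powi (2*d) = t * t\<close> by simp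
      then have "z m * t = t / (1 - t * t) * (z m - z m * (t * t))"
        by (simp add: divide_simps) (simp add: algebra_simps)
      then show ?thesis by simp
    qed
    ultimately show ?thesis by (simp only: t_def[symmetric])
  qed
  have chi_summable: "chi summable_on UNIV"
  proof (rule Infinite_Sum.abs_summable_summable, rule abs_summable_on_int)
    have "chi (int n) = q ^ (2*n+1) * y / (1 - q ^ (2*n+1) * y)" for n
      unfolding chi_def phi_def z_def power_int_odd by simp
    moreover have "summable (\<lambda>n. norm (q ^ (2*n+1) * (y * inverse (1 - q ^ (2*n+1) * y))))"
    proof (rule summable_mult_bounded[OF summable_norm_power])
      show "norm (y * inverse (1 - q ^ (2*n+1) * y)) \<le> norm y * inverse (1 - norm q * norm y)" for n
        unfolding norm_mult by (intro mult_left_mono norm_inverse_one_minus_le y) simp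
    qed simp
    ultimately show "summable (\<lambda>n. norm (chi (int n)))"
      by (simp only: divide_inverse mult.assoc)
    \<comment> \<open>At negative indices \<open>chi\<close> is \<open>1 + phi\<close>, that is
      \<open>1 / (1 - z)\<close>, which decays because \<open>z\<close> grows geometrically.\<close>
    have "chi (- 1 - int n) = - (q ^ (2*n+1) / (y - q ^ (2*n+1)))" for n
    proof -
      have "chi (- 1 - int n) = 1 / (1 - z (- 1 - int n))"
        unfolding chi_def phi_def using den[of "- 1 - int n"] by (simp add: field_simps)
      moreover have "1 / (- b / w) = - (w / b)" for b w :: complex by simp
      ultimately show ?thesis unfolding z_def neg_denominator[OF y] by (simp only:)
    qed
    then show "summable (\<lambda>n. norm (chi (- 1 - int n)))"
      using summable_mult_bounded[OF summable_norm_power[of "\<lambda>n. 2*n+1"] norm_inverse_minus_le[OF y]]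
      by (simp only: divide_inverse norm_minus_cancel)
  qed
  have bij: "bij_betw (\<lambda>m. m + d) UNIV UNIV"
    by (rule bij_betw_byWitness[where f' = "\<lambda>m. m - d"]) auto
  have chi': "(\<lambda>m. chi (m + d)) summable_on UNIV"
    using chi_summable unfolding summable_on_reindex_bij_betw[OF bij] .
  have "finite {m. K m \<noteq> 0}"
    by (rule finite_subset[of _ "{- \<bar>d\<bar>..\<bar>d\<bar>}"]) (auto simp: K_def split: if_splits)
  then have K: "K summable_on UNIV"
    by (intro finite_nonzero_values_imp_summable_on) simp
  have chi_sum: "((\<lambda>m. chi m - chi (m + d)) has_sum 0) UNIV"
  proof -
    have "((\<lambda>m. chi m + - chi (m + d)) has_sum (infsum chi UNIV + - (\<Sum>\<^sub>\<infinity>m. chi (m + d)))) UNIV"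
      by (intro has_sum_add has_sum_infsum chi_summable has_sum_uminusI chi')
    then show ?thesis by (simp add: infsum_reindex_bij_betw[OF bij])
  qed
  have "((\<lambda>m. (chi m - chi (m + d)) + K m) has_sum (0 + infsum K UNIV)) UNIV"
    by (intro has_sum_add chi_sum has_sum_infsum K)
  then have "((\<lambda>m. phi m - phi (m + d)) has_sum (infsum K UNIV)) UNIV"
    by (simp add: chi_def K_def algebra_simps)
  then have "((\<lambda>m. q powi d / (1 - q powi (2*d)) * (phi m - phi (m + d))) has_sum correlation_const d) UNIV"
    unfolding correlation_const_def K_def[symmetric] by (rule has_sum_cmult_right)
  then have "(\<Sum>\<^sub>\<infinity>m. q * y * (kterm y m * kterm y (m + d))) = correlation_const d"
    unfolding pf by (rule infsumI)
  then show ?thesis by (simp only: infsum_cmult_right')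
qed

section \<open>The squared series and its diagonal\<close>

lemma kterm_square:
  assumes y: "y \<in> qannulus"
  shows "q * y * (infsum (kterm y) UNIV)\<^sup>2 =
    (\<Sum>\<^sub>\<infinity>m. q * y * (kterm y m)\<^sup>2) + (\<Sum>\<^sub>\<infinity>d\<in>-{0}. correlation_const d)"
proof -
  let ?c = "\<lambda>d. \<Sum>\<^sub>\<infinity>m. kterm y m * kterm y (m + d)"
  have c: "?c summable_on UNIV"
    by (rule summable_on_correlations[OF abs_summable_kterm[OF y]])
  have "(infsum (kterm y) UNIV)\<^sup>2 = infsum ?c (insert 0 (-{0}))"
    unfolding infsum_square[OF abs_summable_kterm[OF y]] by (rule arg_cong[of _ _ "infsum ?c"]) auto
  also have "\<dots> = ?c 0 + infsum ?c (-{0})"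
    by (rule infsum_insert) (auto intro: summable_on_subset_banach[OF c])
  finally have "q * y * (infsum (kterm y) UNIV)\<^sup>2 = q * y * ?c 0 + q * y * infsum ?c (-{0})"
    by (simp only: distrib_left)
  also have "q * y * ?c 0 = (\<Sum>\<^sub>\<infinity>m. q * y * (kterm y m)\<^sup>2)"
    by (simp add: infsum_cmult_right' power2_eq_square)
  also have "q * y * infsum ?c (-{0}) = (\<Sum>\<^sub>\<infinity>d\<in>-{0}. q * y * ?c d)"
    by (simp only: infsum_cmult_right')
  also have "\<dots> = (\<Sum>\<^sub>\<infinity>d\<in>-{0}. correlation_const d)"
    by (intro infsum_cong kterm_correlation y) auto
  finally show ?thesis .
qed

lemma
  assumes y: "y \<in> qannulus"
  shows infsum_kterm_squares: "(\<Sum>\<^sub>\<infinity>m. q * y * (kterm y m)\<^sup>2) =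
      (\<Sum>n. q ^ (2*n+1) * y / (1 - q ^ (2*n+1) * y)\<^sup>2 + q ^ (2*n+1) * y / (y - q ^ (2*n+1))\<^sup>2)"
    and summable_kterm_squares:
      "summable (\<lambda>n. q ^ (2*n+1) * y / (1 - q ^ (2*n+1) * y)\<^sup>2 + q ^ (2*n+1) * y / (y - q ^ (2*n+1))\<^sup>2)"
proof -
  \<comment> \<open>The prefactor \<open>q * y\<close> completes \<open>q ^ (2*n)\<close> to
    \<open>q ^ (2*n+1) * y\<close>, and the sign at negative indices disappears on squaring.\<close>
  have sq: "q * y * (q ^ n / a)\<^sup>2 = q ^ (2*n+1) * y / a\<^sup>2"
    "q * y * (- (q ^ n / a))\<^sup>2 = q ^ (2*n+1) * y / a\<^sup>2" for n a
    by (simp_all add: power_divide power_mult[symmetric] mult.commute power_minus_even mult_ac)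
  have bound: "norm (y * inverse (a\<^sup>2)) \<le> norm y * B\<^sup>2" if "norm (inverse a) \<le> B" for a B
    using power_mono[OF that, of 2] by (auto simp: norm_mult norm_inverse norm_power power_inverse intro: mult_left_mono)
  have nonneg: "summable (\<lambda>n. norm (q ^ (2*n+1) * y / (1 - q ^ (2*n+1) * y)\<^sup>2))"
    using summable_mult_bounded[OF summable_norm_power[of "\<lambda>n. 2*n+1"] bound[OF norm_inverse_one_minus_le[OF y]]]
    by (simp add: divide_inverse mult.assoc del: power_Suc)
  have neg: "summable (\<lambda>n. norm (q ^ (2*n+1) * y / (y - q ^ (2*n+1))\<^sup>2))"
    using summable_mult_bounded[OF summable_norm_power[of "\<lambda>n. 2*n+1"] bound[OF norm_inverse_minus_le[OF y]]]
    by (simp add: divide_inverse mult.assoc del: power_Suc)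
  have v: "q * y * (kterm y (int n))\<^sup>2 = q ^ (2*n+1) * y / (1 - q ^ (2*n+1) * y)\<^sup>2"
    "q * y * (kterm y (- 1 - int n))\<^sup>2 = q ^ (2*n+1) * y / (y - q ^ (2*n+1))\<^sup>2" for n
    unfolding kterm_nonneg kterm_neg[OF y] sq by (rule refl)+
  show "(\<Sum>\<^sub>\<infinity>m. q * y * (kterm y m)\<^sup>2) =
      (\<Sum>n. q ^ (2*n+1) * y / (1 - q ^ (2*n+1) * y)\<^sup>2 + q ^ (2*n+1) * y / (y - q ^ (2*n+1))\<^sup>2)"
    by (subst infsum_int) (simp_all only: v nonneg neg)
  show "summable (\<lambda>n. q ^ (2*n+1) * y / (1 - q ^ (2*n+1) * y)\<^sup>2 + q ^ (2*n+1) * y / (y - q ^ (2*n+1))\<^sup>2)"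
    by (rule summable_add[OF summable_norm_cancel[OF nonneg] summable_norm_cancel[OF neg]])
qed

text \<open>Each pair of diagonal terms is symmetric under replacing \<open>y\<close> by its
  inverse, so its difference from the value at 1 vanishes to second order there. The factor
  \<open>(y - 1)\<close> squared therefore comes out of every summand and can be cancelled on both
  sides.\<close>

lemma kronecker_square_difference:
  assumes y: "y \<in> qannulus" and y1: "y \<noteq> 1"
  shows "q * y * (\<Sum>n. q ^ n * (1 + q ^ (2*n+1)) * inverse (pairden y n))\<^sup>2 =
    (\<Sum>n. q ^ (2*n+1) * (1 + q ^ (2*n+1))\<^sup>2 * (y * (inverse (pairden y n))\<^sup>2) +
         2 * (q ^ (2*n+1))\<^sup>2 / (1 - q ^ (2*n+1))\<^sup>2 * inverse (pairden y n))" (is "_ * (?A)\<^sup>2 = suminf ?Q")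
proof -
  let ?s = "\<lambda>y n. q ^ (2*n+1) * y / (1 - q ^ (2*n+1) * y)\<^sup>2 + q ^ (2*n+1) * y / (y - q ^ (2*n+1))\<^sup>2"
  let ?C = "\<Sum>\<^sub>\<infinity>d\<in>-{0}. correlation_const d"
  have "infsum (kterm 1) UNIV = 0"
    using infsum_kterm[OF one_in_qannulus] by simp
  \<comment> \<open>Evaluation at \<open>y = 1\<close>, where the left side vanishes, determines the
    off-diagonal constant without summing it.\<close>
  then have "?C = - (\<Sum>n. ?s 1 n)"
    using kterm_square[OF one_in_qannulus] infsum_kterm_squares[OF one_in_qannulus]
    by (simp add: eq_neg_iff_add_eq_0 add.commute)
  then have "q * y * ((y - 1) * ?A)\<^sup>2 = (\<Sum>n. ?s y n) - (\<Sum>n. ?s 1 n)"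
    using kterm_square[OF y] unfolding infsum_kterm[OF y] infsum_kterm_squares[OF y] by simp
  also have "\<dots> = (\<Sum>n. ?s y n - ?s 1 n)"
    by (rule suminf_diff[OF summable_kterm_squares[OF y] summable_kterm_squares[OF one_in_qannulus]])
  also have "\<dots> = (\<Sum>n. (y - 1)\<^sup>2 * ?Q n)"
  proof (rule arg_cong[of _ _ suminf], rule ext)
    fix n
    have "(x * y / a\<^sup>2 + x * y / b\<^sup>2) - (x * 1 / c\<^sup>2 + x * 1 / c\<^sup>2) =
      (y - 1)\<^sup>2 * (x * (1 + x)\<^sup>2 * (y * (inverse (a * b))\<^sup>2) + 2 * x\<^sup>2 / c\<^sup>2 * inverse (a * b))"
      if nz: "a \<noteq> 0" "b \<noteq> 0" "c \<noteq> 0" and abc: "a = 1 - x * y" "b = y - x" "c = 1 - x" for a b c x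
    proof -
      \<comment> \<open>Here \<open>b - a = (1 + x) * (y - 1)\<close>, so this is the expansion of
        \<open>(b - a)\<close> squared. The second identity compares \<open>a * b\<close> with
        \<open>y * c\<^sup>2\<close>, from which it differs only to second order at
        \<open>y = 1\<close>.\<close>
      have 1: "a\<^sup>2 + b\<^sup>2 = (1 + x)\<^sup>2 * (y - 1)\<^sup>2 + 2 * (a * b)"
        unfolding abc by algebra
      have 2: "y * c\<^sup>2 - a * b = x * (y - 1)\<^sup>2"
        unfolding abc by algebra
      have "x * y / a\<^sup>2 + x * y / b\<^sup>2 = x * y * (a\<^sup>2 + b\<^sup>2) / (a * b)\<^sup>2"
        using nz by (simp add: field_simps power2_eq_square)
      also have "\<dots> = (y - 1)\<^sup>2 * (x * (1 + x)\<^sup>2 * y / (a * b)\<^sup>2) + 2 * x * y / (a * b)"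
        unfolding 1 using nz by (simp add: field_simps power2_eq_square)
      finally have 3: "x * y / a\<^sup>2 + x * y / b\<^sup>2 = \<dots>" .
      have "2 * x * y / (a * b) - 2 * x / c\<^sup>2 = 2 * x * (y * c\<^sup>2 - a * b) / (c\<^sup>2 * (a * b))"
        using nz by (simp add: field_simps power2_eq_square)
      also have "\<dots> = (y - 1)\<^sup>2 * (2 * x\<^sup>2 / c\<^sup>2 * inverse (a * b))"
        unfolding 2 using nz by (simp add: field_simps power2_eq_square)
      finally have "2 * x * y / (a * b) = 2 * x / c\<^sup>2 + \<dots>"
        by (simp only: diff_eq_eq add.commute)
      then show ?thesis unfolding 3
        by (simp add: divide_inverse power_inverse power_mult_distrib distrib_left mult_ac)
    qed
    from this[OF one_minus_mult_nonzero[OF y, of n] minus_power_nonzero[OF y, of n]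
        minus_power_nonzero[OF one_in_qannulus, of n] refl refl refl]
    show "?s y n - ?s 1 n = (y - 1)\<^sup>2 * ?Q n"
      unfolding pairden_def mult_1_right .
  qed
  also have "\<dots> = (y - 1)\<^sup>2 * suminf ?Q"
    by (rule suminf_mult[OF summable_add]; rule summable_norm_cancel)
       (rule summable_mult_bounded[OF summable_norm_mult_square norm_inverse_pairden_sq_le[OF y]]
          summable_mult_bounded[OF summable_norm_div_square norm_inverse_pairden_le[OF y]])+
  finally have "(y - 1)\<^sup>2 * (q * y * ?A\<^sup>2) = (y - 1)\<^sup>2 * suminf ?Q"
    by (simp only: power_mult_distrib mult.left_commute)
  then show ?thesis unfolding mult_cancel_left using y1 by simp
qed

lemma kronecker_square_limit_sums:
  "(\<lambda>n. q ^ (2*n+1) * (1 + q ^ (2*n+1))\<^sup>2 * (1 * (inverse (pairden 1 n))\<^sup>2) +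
         2 * (q ^ (2*n+1))\<^sup>2 / (1 - q ^ (2*n+1))\<^sup>2 * inverse (pairden 1 n))
   sums (q * (\<Sum>n. q ^ n * (1 + q ^ (2*n+1)) * inverse (pairden 1 n))\<^sup>2)"
proof -
  \<comment> \<open>With \<open>norm q = 1 - 2 * \<delta>\<close>, both
    \<open>norm y - norm q\<close> and \<open>1 - norm q * norm y\<close> are at least
    \<open>\<delta>\<close> on the disc of radius \<open>\<delta>\<close> about 1. This makes the
    bounds on \<open>pairden\<close> uniform in \<open>y\<close>.\<close>
  define \<delta> where "\<delta> = (1 - norm q) / 2"
  have norm_q: "norm q = 1 - 2 * \<delta>" by (simp add: \<delta>_def field_simps)
  have \<delta>: "\<delta> > 0" "\<delta> < 1" using norm_q q1 norm_ge_zero[of q] by auto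
  have near: "\<forall>\<^sub>F y in at (1::complex). dist y 1 < \<delta> \<and> y \<noteq> 1"
    using \<delta>(1) unfolding eventually_at by (intro exI[of _ \<delta>]) auto
  have props: "y \<in> qannulus \<and> norm y \<le> 2 \<and> (\<forall>n. norm (inverse (pairden y n)) \<le> inverse \<delta> * inverse \<delta>)"
    if "dist y 1 < \<delta>" for y
  proof -
    have "norm (1::complex) - norm (1 - y) \<le> norm y" "norm y \<le> norm (1::complex) + norm (y - 1)"
      using norm_triangle_ineq2[of 1 "1 - y"] norm_triangle_ineq[of 1 "y - 1"] by simp_all
    then have y: "norm y \<ge> 1 - \<delta>" "norm y \<le> 1 + \<delta>"
      using that by (simp_all add: dist_norm norm_minus_commute)
    have "norm q * norm y \<le> norm q * (1 + \<delta>)" using y by (intro mult_left_mono) auto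
    also have "\<dots> = 1 - \<delta> - 2 * \<delta>\<^sup>2" unfolding norm_q by (simp add: algebra_simps power2_eq_square)
    finally have 1: "1 - norm q * norm y \<ge> \<delta>" using zero_le_power2[of \<delta>] by linarith
    have 2: "norm y - norm q \<ge> \<delta>" using y norm_q by simp
    have ann: "y \<in> qannulus" using 1 2 \<delta>(1) by (simp add: qannulus_def)
    have "inverse (1 - norm q * norm y) * inverse (norm y - norm q) \<le> inverse \<delta> * inverse \<delta>"
      using 1 2 \<delta>(1) by (intro mult_mono le_imp_inverse_le) auto
    with norm_inverse_pairden_le[OF ann] have "norm (inverse (pairden y n)) \<le> inverse \<delta> * inverse \<delta>" for n
      using order.trans by blast
    then show ?thesis using ann y \<delta> by auto
  qed
  have bound1: "\<forall>\<^sub>F y in at 1. \<forall>n. norm (inverse (pairden y n)) \<le> inverse \<delta> * inverse \<delta>"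
    using near by eventually_elim (use props in blast)
  have bound2: "\<forall>\<^sub>F y in at 1. \<forall>n. norm (y * (inverse (pairden y n))\<^sup>2) \<le> 2 * (inverse \<delta> * inverse \<delta>)\<^sup>2"
    using near
  proof eventually_elim
    case (elim y)
    show ?case unfolding norm_mult norm_power
      using props[of y] elim by (intro allI mult_mono power_mono) auto
  qed
  have "pairden 1 n \<noteq> 0" for n
    using one_minus_mult_nonzero[OF one_in_qannulus, of n] minus_power_nonzero[OF one_in_qannulus, of n]
    by (simp add: pairden_def)
  then have lim: "((\<lambda>y. inverse (pairden y n)) \<longlongrightarrow> inverse (pairden 1 n)) (at 1)" for n
    unfolding pairden_def by (intro tendsto_intros) auto
  have limA: "((\<lambda>y. \<Sum>n. q ^ n * (1 + q ^ (2*n+1)) * inverse (pairden y n)) \<longlongrightarrow>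
      (\<Sum>n. q ^ n * (1 + q ^ (2*n+1)) * inverse (pairden 1 n))) (at 1)" (is "(?A \<longlongrightarrow> _) _")
    by (rule tannery_bounded_factor[OF summable_norm_pair bound1 lim]) simp
  have lim1: "((\<lambda>y. \<Sum>n. q ^ (2*n+1) * (1 + q ^ (2*n+1))\<^sup>2 * (y * (inverse (pairden y n))\<^sup>2)) \<longlongrightarrow>
      (\<Sum>n. q ^ (2*n+1) * (1 + q ^ (2*n+1))\<^sup>2 * (1 * (inverse (pairden 1 n))\<^sup>2))) (at 1)" (is "(?Q1 \<longlongrightarrow> _) _")
    by (rule tannery_bounded_factor[OF summable_norm_mult_square bound2 tendsto_mult[OF tendsto_ident_at tendsto_power[OF lim]]]) simp
  have lim2: "((\<lambda>y. \<Sum>n. 2 * (q ^ (2*n+1))\<^sup>2 / (1 - q ^ (2*n+1))\<^sup>2 * inverse (pairden y n)) \<longlongrightarrow>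
      (\<Sum>n. 2 * (q ^ (2*n+1))\<^sup>2 / (1 - q ^ (2*n+1))\<^sup>2 * inverse (pairden 1 n))) (at 1)" (is "(?Q2 \<longlongrightarrow> _) _")
    by (rule tannery_bounded_factor[OF summable_norm_div_square bound1 lim]) simp
  have split: "(\<lambda>n. q ^ (2*n+1) * (1 + q ^ (2*n+1))\<^sup>2 * (y * (inverse (pairden y n))\<^sup>2) +
         2 * (q ^ (2*n+1))\<^sup>2 / (1 - q ^ (2*n+1))\<^sup>2 * inverse (pairden y n)) sums (?Q1 y + ?Q2 y)"
    if "y \<in> qannulus" for y
    by (rule sums_add; rule summable_sums; rule summable_norm_cancel)
       (rule summable_mult_bounded[OF summable_norm_mult_square norm_inverse_pairden_sq_le[OF that]]
          summable_mult_bounded[OF summable_norm_div_square norm_inverse_pairden_le[OF that]])+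
  have "((\<lambda>y. q * y * (?A y)\<^sup>2) \<longlongrightarrow> q * 1 * (?A 1)\<^sup>2) (at 1)"
    by (intro tendsto_intros limA)
  moreover have "\<forall>\<^sub>F y in at 1. q * y * (?A y)\<^sup>2 = ?Q1 y + ?Q2 y"
    using near
  proof eventually_elim
    case (elim y)
    then have y: "y \<in> qannulus" "y \<noteq> 1" using props[of y] by auto
    show ?case unfolding kronecker_square_difference[OF y] by (rule sums_unique[OF split[OF y(1)], symmetric])
  qed
  ultimately have "((\<lambda>y. ?Q1 y + ?Q2 y) \<longlongrightarrow> q * 1 * (?A 1)\<^sup>2) (at 1)"
    by (rule Lim_transform_eventually)
  then have "q * 1 * (?A 1)\<^sup>2 = ?Q1 1 + ?Q2 1"
    by (rule tendsto_unique[OF _ _ tendsto_add[OF lim1 lim2], rotated]) simp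
  then show ?thesis using split[OF one_in_qannulus] by (simp only: mult_1_right)
qed

lemma eight_triangular_sums:
  "(\<lambda>k. q ^ (2*k) * P2 (q ^ (2*k+1)) / (1 - q ^ (2*k+1)) ^ 4) sums ((evenprodinf q / oddprodinf q) ^ 8)"
proof -
  have den: "inverse (pairden 1 n) = inverse ((1 - q ^ (2*n+1))\<^sup>2)" for n
    unfolding pairden_def by (simp only: mult_1_right power2_eq_square)
  have "(\<Sum>n. q ^ n * (1 + q ^ (2*n+1)) * inverse (pairden 1 n)) = (evenprodinf q / oddprodinf q) ^ 4"
    unfolding den divide_inverse[symmetric] by (rule sums_unique[OF four_triangular_sums, symmetric])
  then have square: "(\<Sum>n. q ^ n * (1 + q ^ (2*n+1)) * inverse (pairden 1 n))\<^sup>2 = (evenprodinf q / oddprodinf q) ^ 8"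
    by (simp flip: power_mult)
  \<comment> \<open>Over the common denominator the numerator is
    \<open>x * ((1 + x)\<^sup>2 + 2 * x)\<close>, and this is where \<open>P2\<close>
    arises.\<close>
  have "x * (1 + x)\<^sup>2 * (1 * (inverse (a\<^sup>2))\<^sup>2) + 2 * x\<^sup>2 / a\<^sup>2 * inverse (a\<^sup>2) = x * P2 x / a ^ 4"
    if "a \<noteq> 0" for a x
    using that by (simp add: P2_def field_simps power2_eq_square power4_eq_xxxx)
  note combine = this[OF one_minus_power_nonzero[OF q1]]
  have "(\<lambda>n. q ^ (2*n+1) * P2 (q ^ (2*n+1)) / (1 - q ^ (2*n+1)) ^ 4) sums (q * (evenprodinf q / oddprodinf q) ^ 8)"
    using kronecker_square_limit_sums 
    unfolding den square[unfolded den] by (simp only: combine zero_less_Suc Suc_eq_plus1[symmetric])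
  then have "(\<lambda>n. q * (q ^ (2*n) * P2 (q ^ (2*n+1)) / (1 - q ^ (2*n+1)) ^ 4)) sums (q * (evenprodinf q / oddprodinf q) ^ 8)"
    by (simp add: mult_ac)
  \<comment> \<open>One factor \<open>q\<close> from \<open>x = q * q ^ (2*n)\<close> is cancelled
    against the \<open>q\<close> on the right.\<close>
  from sums_mult_D[OF this q0] show ?thesis using q0 by simp
qed

end

section \<open>Conclusion, including the degenerate case q = 0\<close>

theorem theorem2p1:
  fixes q :: complex
  assumes "norm q < 1"
  shows "summable (\<lambda>k. q ^ (2 * k) * P2 (q ^ (2 * k + 1)) / (1 - q ^ (2 * k + 1)) ^ 4)
    \<and> convergent_prod (\<lambda>n. (1 - q ^ (2 * Suc n)) ^ 8 / (1 - q ^ (2 * Suc n - 1)) ^ 8)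
    \<and> (\<Sum>k. q ^ (2 * k) * P2 (q ^ (2 * k + 1)) / (1 - q ^ (2 * k + 1)) ^ 4)
      = (\<Prod>n. (1 - q ^ (2 * Suc n)) ^ 8 / (1 - q ^ (2 * Suc n - 1)) ^ 8)"
proof -
  define V where "V = (evenprodinf q / oddprodinf q) ^ 8"
  have prod: "(\<lambda>n. (1 - q ^ (2 * Suc n)) ^ 8 / (1 - q ^ (2 * Suc n - 1)) ^ 8) has_prod V"
  proof -
    have "(\<lambda>n. (1 - q ^ (2*n+2)) ^ 8 / (1 - q ^ (2*n+1)) ^ 8) has_prod V"
      unfolding V_def power_divide
      by (intro has_prod_divide has_prod_power has_prod_evenprodinf has_prod_oddprodinf assms)
    then show ?thesis by simp
  qed
  have "(\<lambda>k. q ^ (2*k) * P2 (q ^ (2*k+1)) / (1 - q ^ (2*k+1)) ^ 4) sums V"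
  \<comment> \<open>The bilateral series uses negative powers of \<open>q\<close>, so 0 is treated
    apart. There every factor of the product is 1, and only the term \<open>k = 0\<close> survives,
    with \<open>0 ^ 0 = 1\<close> and \<open>P2 0 = 1\<close>.\<close>
  proof (cases "q = 0")
    case True
    have "V = 1"
      using has_prod_unique2[OF prod] True by simp
    moreover have "(\<lambda>k. q ^ (2*k) * P2 (q ^ (2*k+1)) / (1 - q ^ (2*k+1)) ^ 4) = (\<lambda>k. if k = 0 then 1 else 0)"
      using True by (auto simp: P2_def power_0_left)
    ultimately show ?thesis using sums_single[of 0 "\<lambda>_. 1 :: complex"] by simp
  next
    case False
    then show ?thesis unfolding V_def by (rule eight_triangular_sums[OF _ assms])
  qed
  with prod show ?thesis
    by (auto simp: sums_iff has_prod_iff)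
qed

end
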